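(* Let $X$ be a separable infinite-dimensional Fréchet space and $T$ a continuous linear operator on $X$. Then \[FHC(T)=\bigcap_{a\in\mathcal{A}}FHC_a(T)=\bigcap_{a\in\mathcal{A}}UFHC_a(T).\]
   Context: For a sequence $a=(a_n)_{n\ge 0}$ of positive real numbers with $\sum_{n=0}^\infty a_n=\infty$ and a set $I$ of non-negative integers, define \[\overline{d_a}(I)=\limsup_{N\to\infty}\frac{\sum_{n\in[0,N]\cap I}a_n}{\sum_{n=0}^N a_n},\qquad \underline{d_a}(I)=\liminf_{N\to\infty}\frac{\sum_{n\in[0,N]\cap I}a_n}{\sum_{n=0}^N a_n}.\] The unweighted upper and lower densities $\overline{d}$, $\underline{d}$ correspond to $a_n=1$ for all $n$. $\mathcal{A}$ denotes the set of all sequences $a=(a_n)_{n\ge0}$ of positive real numbers which are decreasing (in the wide sense, i.e. $a_{n+1}\le a_n$ for all $n$), tend to $0$, and satisfy $\sum_{n=0}^\infty a_n=\infty$. For $x\in X$ and $U\subset X$, put $N(x,U)=\{n\ge 0: T^nx\in U\}$. Then: - $FHC(T)$ is the set of $x\in X$ such that $\underline{d}(N(x,U))>0$ for every non-empty open set $U\subset X$; - $FHC_a(T)$ is the set of $x\in X$ such that $\underline{d_a}(N(x,U))>0$ for every non-empty open set $U\subset X$; - $UFHC_a(T)$ is the set of $x\in X$ such that $\overline{d_a}(N(x,U))>0$ for every non-empty open set $U\subset X$. *)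

theory Defs
  imports "HOL-Analysis.Analysis"
begin

text \<open>
  By the Gelfand-Mazur theorem the fields of class \<open>real_normed_field\<close>
  are, up to isometric isomorphism, exactly the real and the complex numbers. A scalar
  multiplication \<open>smul :: 'k::real_normed_field \<Rightarrow> 'a \<Rightarrow> 'a\<close> therefore
  covers real and complex spaces simultaneously.
\<close>

definition is_seminorm ::
    "('k::real_normed_field \<Rightarrow> 'a::ab_group_add \<Rightarrow> 'a) \<Rightarrow> ('a \<Rightarrow> real) \<Rightarrow> bool" where
  "is_seminorm smul p \<longleftrightarrow>
     (\<forall>x. 0 \<le> p x) \<and>
     (\<forall>x y. p (x + y) \<le> p x + p y) \<and>
     (\<forall>c x. p (smul c x) = norm c * p x)"

text \<open>
  A Frechet space is a vector space whose topology (here the one of the type class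
  \<open>topological_space\<close>) is induced by a separating sequence of seminorms
  with respect to which every Cauchy sequence converges. The sequence of seminorms is not
  required to be increasing, so basic neighbourhoods use finitely many seminorms at a time.
\<close>

definition frechet_space ::
    "('k::real_normed_field \<Rightarrow> 'a::{ab_group_add, topological_space} \<Rightarrow> 'a) \<Rightarrow> bool" where
  "frechet_space smul \<longleftrightarrow>
     vector_space smul \<and>
     (\<exists>p :: nat \<Rightarrow> 'a \<Rightarrow> real.
        (\<forall>i. is_seminorm smul (p i)) \<and>
        (\<forall>x. (\<forall>i. p i x = 0) \<longrightarrow> x = 0) \<and>
        (\<forall>U. open U \<longleftrightarrow>
             (\<forall>x\<in>U. \<exists>n. \<exists>e>0. {y. \<forall>i\<le>n. p i (y - x) < e} \<subseteq> U)) \<and>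
        (\<forall>s :: nat \<Rightarrow> 'a.
             (\<forall>i. \<forall>e>0. \<exists>M. \<forall>m\<ge>M. \<forall>n\<ge>M. p i (s m - s n) < e) \<longrightarrow>
             (\<exists>l. s \<longlonglongrightarrow> l)))"

definition upper_density_wrt :: "(nat \<Rightarrow> real) \<Rightarrow> nat set \<Rightarrow> ereal" where
  "upper_density_wrt a I =
     limsup (\<lambda>N. ereal ((\<Sum>n\<in>{0..N} \<inter> I. a n) / (\<Sum>n=0..N. a n)))"

definition lower_density_wrt :: "(nat \<Rightarrow> real) \<Rightarrow> nat set \<Rightarrow> ereal" where
  "lower_density_wrt a I =
     liminf (\<lambda>N. ereal ((\<Sum>n\<in>{0..N} \<inter> I. a n) / (\<Sum>n=0..N. a n)))"

definition lower_density :: "nat set \<Rightarrow> ereal" where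
  "lower_density = lower_density_wrt (\<lambda>n. 1)"

definition admissible_weights :: "(nat \<Rightarrow> real) set" where
  "admissible_weights =
     {a. (\<forall>n. 0 < a n) \<and> decseq a \<and> a \<longlonglongrightarrow> 0 \<and>
         filterlim (\<lambda>N. \<Sum>n=0..N. a n) at_top sequentially}"

definition return_times :: "('a \<Rightarrow> 'a) \<Rightarrow> 'a \<Rightarrow> 'a set \<Rightarrow> nat set" where
  "return_times T x U = {n. (T ^^ n) x \<in> U}"

definition FHC :: "('a::topological_space \<Rightarrow> 'a) \<Rightarrow> 'a set" where
  "FHC T = {x. \<forall>U. open U \<and> U \<noteq> {} \<longrightarrow> 0 < lower_density (return_times T x U)}"

definition FHC_wrt :: "(nat \<Rightarrow> real) \<Rightarrow> ('a::topological_space \<Rightarrow> 'a) \<Rightarrow> 'a set" where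
  "FHC_wrt a T =
     {x. \<forall>U. open U \<and> U \<noteq> {} \<longrightarrow> 0 < lower_density_wrt a (return_times T x U)}"

definition UFHC_wrt :: "(nat \<Rightarrow> real) \<Rightarrow> ('a::topological_space \<Rightarrow> 'a) \<Rightarrow> 'a set" where
  "UFHC_wrt a T =
     {x. \<forall>U. open U \<and> U \<noteq> {} \<longrightarrow> 0 < upper_density_wrt a (return_times T x U)}"

end

theory Submission
  imports Defs
begin

text \<open>
  The theorem is a statement about the densities of a single set of integers, applied to the
  return-time sets of an orbit. Two facts carry it.

  For a decreasing weight with divergent sum, the weighted lower density dominates the
  unweighted one: by summation by parts, a decreasing weight is a positive combination of
  indicators of initial segments, so a lower bound for the proportion of the set in every long
  initial segment survives the averaging (\<open>lower_density_le_lower_density_wrt\<close>).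
  Hence a frequently hypercyclic vector is frequently hypercyclic for every admissible weight,
  and a fortiori upper frequently hypercyclic.

  Conversely, a set \<open>I\<close> of lower density zero has upper weighted density zero for a suitable
  admissible weight (\<open>obtain_weight_with_zero_upper_density\<close>). Pick lengths \<open>M k\<close>, at least
  \<open>2 ^ k\<close>, such that \<open>I\<close> occupies a proportion at most \<open>1 / 2 ^ k\<close> of \<open>{..<M k}\<close>, and let the
  weight be the sum over \<open>k\<close> of the uniform probabilities on the segments \<open>{..<M k}\<close>. Each
  segment contributes total mass one, so the weight has infinite sum, whereas the mass carried
  by \<open>I\<close> is at most the sum of the \<open>1 / 2 ^ k\<close>, hence finite. The weight adapted to the
  return times to an open set that witness the failure of frequent hypercyclicity therefore
  excludes the vector from upper frequent hypercyclicity too.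
\<close>

section \<open>Decreasing weights do not lose lower density\<close>

text \<open>
  The induction runs on the sharper bound \<open>a n * ((\<Sum>i\<le>n. b i) + C) - C * a 0\<close>: since the partial
  sums of \<open>b\<close> shifted by \<open>C\<close> are nonnegative, replacing \<open>a n\<close> by the smaller \<open>a (Suc n)\<close>
  only decreases it.
\<close>

lemma sum_decseq_mult_ge:
  fixes a b :: "nat \<Rightarrow> real"
  assumes "decseq a" "\<And>n. 0 \<le> a n" "\<And>n. - C \<le> (\<Sum>i\<le>n. b i)"
  shows "- C * a 0 \<le> (\<Sum>i\<le>n. a i * b i)"
proof -
  have "a n * ((\<Sum>i\<le>n. b i) + C) - C * a 0 \<le> (\<Sum>i\<le>n. a i * b i)"
  proof (induction n)
    case 0
    then show ?case by (simp add: algebra_simps)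
  next
    case (Suc n)
    have "a (Suc n) * ((\<Sum>i\<le>n. b i) + C) \<le> a n * ((\<Sum>i\<le>n. b i) + C)"
      using assms(3)[of n] decseq_SucD[OF assms(1)] by (intro mult_right_mono) auto
    with Suc show ?case by (simp add: algebra_simps)
  qed
  moreover have "0 \<le> a n * ((\<Sum>i\<le>n. b i) + C)"
    using assms(2)[of n] assms(3)[of n] by (intro mult_nonneg_nonneg) auto
  ultimately show ?thesis by simp
qed

text \<open>
  For \<open>c\<close> below the lower density, the partial sums of \<open>indicator I n - c\<close> are bounded below, so
  summation by parts gives that the weighted mass of \<open>I\<close> is at least \<open>c\<close> times the total mass
  up to an additive constant. As the total mass diverges, the constant costs nothing in the
  limit: it is absorbed by the gap between \<open>c\<close> and a slightly smaller \<open>d\<close>.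
\<close>

lemma lower_density_le_lower_density_wrt:
  assumes a: "a \<in> admissible_weights"
  shows "lower_density I \<le> lower_density_wrt a I"
  unfolding lower_density_wrt_def le_Liminf_iff
proof (intro allI impI)
  fix y :: ereal
  assume "y < lower_density I"
  then obtain d where d: "y < ereal d" "ereal d < lower_density I"
    using ereal_dense2 by blast
  then obtain c where c: "ereal d < ereal c" "ereal c < lower_density I"
    using ereal_dense2 by blast
  define S where "S = (\<lambda>N. \<Sum>n=0..N. a n)"
  define b where "b = (\<lambda>n. indicator I n - c :: real)"
  have pos: "\<And>n. 0 < a n" and dec: "decseq a" and lim: "filterlim S at_top sequentially"
    using a by (auto simp: admissible_weights_def S_def)
  have "\<forall>\<^sub>F N in sequentially. ereal c < ereal ((\<Sum>n\<in>{0..N} \<inter> I. 1) / (\<Sum>n=0..N. 1))"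
    using c(2) less_LiminfD unfolding lower_density_def lower_density_wrt_def by blast
  then obtain N0 where N0: "\<And>N. N \<ge> N0 \<Longrightarrow> c < real (card ({0..N} \<inter> I)) / (real N + 1)"
    by (auto simp: eventually_sequentially add.commute)
  have sum_I: "(\<Sum>n\<in>{0..N} \<inter> I. f n) = (\<Sum>n\<le>N. f n * indicator I n)" for f :: "nat \<Rightarrow> real" and N
    by (auto simp: sum.inter_restrict atLeast0AtMost indicator_def intro!: sum.cong)
  have sum_b: "(\<Sum>n\<le>N. b n) = real (card ({0..N} \<inter> I)) - c * (real N + 1)" for N
    using sum_I[of "\<lambda>_. 1" N] by (simp add: b_def sum_subtractf algebra_simps)
  \<comment> \<open>Only the finitely many partial sums before \<open>N0\<close> can be negative.\<close>
  have "- (\<bar>c\<bar> * (real N0 + 1)) \<le> (\<Sum>n\<le>N. b n)" for N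
  proof (cases "N \<ge> N0")
    case True
    have "0 \<le> (\<Sum>n\<le>N. b n)"
      using N0[OF True] by (simp add: sum_b field_simps)
    moreover have "0 \<le> \<bar>c\<bar> * (real N0 + 1)" by simp
    ultimately show ?thesis by linarith
  next
    case False
    have "c * (real N + 1) \<le> \<bar>c\<bar> * (real N0 + 1)"
      using False by (intro mult_mono) auto
    then show ?thesis by (simp add: sum_b)
  qed
  then have "- (\<bar>c\<bar> * (real N0 + 1)) * a 0 \<le> (\<Sum>n\<le>N. a n * b n)" for N
    by (intro sum_decseq_mult_ge dec less_imp_le[OF pos])
  moreover have "(\<Sum>n\<le>N. a n * b n) = (\<Sum>n\<in>{0..N} \<inter> I. a n) - c * S N" for N
    unfolding sum_I
    by (simp add: b_def S_def atLeast0AtMost right_diff_distrib sum_subtractf sum_distrib_left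
        mult.commute)
  ultimately have ge: "c * S N - \<bar>c\<bar> * (real N0 + 1) * a 0 \<le> (\<Sum>n\<in>{0..N} \<inter> I. a n)" for N
    by (simp add: algebra_simps)
  have "\<forall>\<^sub>F N in sequentially. S N > \<bar>c\<bar> * (real N0 + 1) * a 0 / (c - d)"
    using lim by (simp add: filterlim_at_top_dense)
  then show "\<forall>\<^sub>F N in sequentially. y < ereal ((\<Sum>n\<in>{0..N} \<inter> I. a n) / (\<Sum>n=0..N. a n))"
  proof eventually_elim
    case (elim N)
    have S: "0 < S N" unfolding S_def using pos by (intro sum_pos) auto
    have "\<bar>c\<bar> * (real N0 + 1) * a 0 < (c - d) * S N"
      using elim c(1) by (simp add: field_simps)
    then have "d * S N < (\<Sum>n\<in>{0..N} \<inter> I. a n)"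
      using ge[of N] by (simp add: algebra_simps)
    then have "d < (\<Sum>n\<in>{0..N} \<inter> I. a n) / S N"
      using S by (simp add: field_simps)
    then have "ereal d < ereal ((\<Sum>n\<in>{0..N} \<inter> I. a n) / S N)" by simp
    with d(1) show ?case unfolding S_def by (rule less_trans)
  qed
qed

section \<open>A weight that ignores a set of lower density zero\<close>

lemma lower_density_eq_0_sparse_segments:
  assumes "\<not> 0 < lower_density I" "0 < e"
  shows "\<exists>M\<ge>m. 0 < M \<and> real (card ({..<M} \<inter> I)) \<le> e * real M"
proof (rule ccontr)
  assume neg: "\<not> ?thesis"
  have "ereal e \<le> ereal ((\<Sum>n\<in>{0..N} \<inter> I. 1) / (\<Sum>n=0..N. 1))" if "N \<ge> m" for N
  proof -
    have "{..<Suc N} = {0..N}" by auto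
    then have "e * (real N + 1) < real (card ({0..N} \<inter> I))"
      using neg that by (smt (verit) le_SucI of_nat_Suc zero_less_Suc)
    then show ?thesis by (simp add: field_simps)
  qed
  then have "ereal e \<le> lower_density I"
    unfolding lower_density_def lower_density_wrt_def
    by (intro Liminf_bounded) (auto simp: eventually_sequentially)
  moreover have "(0::ereal) < ereal e" using assms(2) by simp
  ultimately show False using assms(1) by (meson less_le_trans)
qed

lemma upper_density_wrt_eq_0:
  assumes a: "a \<in> admissible_weights" and bound: "\<And>N. (\<Sum>n\<in>{0..N} \<inter> I. a n) \<le> B"
  shows "upper_density_wrt a I = 0"
proof -
  define S where "S = (\<lambda>N. \<Sum>n=0..N. a n)"
  have pos: "\<And>n. 0 < a n" and lim: "filterlim S at_top sequentially"
    using a by (auto simp: admissible_weights_def S_def)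
  have S: "0 < S N" for N unfolding S_def using pos by (intro sum_pos) auto
  have "(\<lambda>N. (\<Sum>n\<in>{0..N} \<inter> I. a n) / S N) \<longlonglongrightarrow> 0"
  proof (rule tendsto_sandwich[where f = "\<lambda>_. 0"])
    show "(\<lambda>N. B / S N) \<longlonglongrightarrow> 0"
      by (intro tendsto_divide_0[OF tendsto_const] filterlim_at_top_imp_at_infinity lim)
    show "\<forall>\<^sub>F N in sequentially. 0 \<le> (\<Sum>n\<in>{0..N} \<inter> I. a n) / S N"
      by (intro always_eventually allI divide_nonneg_nonneg sum_nonneg less_imp_le[OF pos]
          less_imp_le[OF S])
    show "\<forall>\<^sub>F N in sequentially. (\<Sum>n\<in>{0..N} \<inter> I. a n) / S N \<le> B / S N"
      by (intro always_eventually allI divide_right_mono bound less_imp_le[OF S])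
  qed simp
  then have "(\<lambda>N. ereal ((\<Sum>n\<in>{0..N} \<inter> I. a n) / S N)) \<longlonglongrightarrow> ereal 0"
    by (simp add: tendsto_ereal)
  then show ?thesis
    unfolding upper_density_wrt_def S_def by (simp add: lim_imp_Limsup zero_ereal_def)
qed

definition uniform_weight :: "nat \<Rightarrow> nat \<Rightarrow> real" where
  "uniform_weight m n = (if n < m then 1 / real m else 0)"

lemma sum_uniform_weight:
  assumes "finite A"
  shows "(\<Sum>n\<in>A. uniform_weight m n) = real (card ({..<m} \<inter> A)) / real m"
proof -
  have "(\<Sum>n\<in>A. uniform_weight m n) = (\<Sum>n\<in>A \<inter> {..<m}. 1 / real m)"
    unfolding uniform_weight_def sum.inter_restrict[OF assms] by simp
  then show ?thesis by (simp add: Int_commute)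
qed

text \<open>
  The weight is \<open>\<Sum>k. uniform_weight (M k) n\<close>. It is decreasing because every summand is. The
  bound \<open>2 ^ k \<le> M k\<close> dominates the summands by a geometric series, which gives convergence and
  the limit zero, and it puts every \<open>n\<close> in the segment \<open>{..<M n}\<close>, which gives positivity.
  The \<open>k\<close>-th summand gives every part of \<open>I\<close> mass at most \<open>(1/2) ^ k\<close>, whatever the end \<open>N\<close> of
  the window, which bounds the mass of \<open>I\<close> up to \<open>N\<close> for all \<open>N\<close> and not only along a subsequence.
\<close>

lemma obtain_weight_with_zero_upper_density:
  assumes "\<not> 0 < lower_density I"
  obtains a where "a \<in> admissible_weights" "upper_density_wrt a I = 0"
proof -
  have "\<forall>k. \<exists>M. 2 ^ k \<le> M \<and> 0 < M \<and> real (card ({..<M} \<inter> I)) \<le> (1/2) ^ k * real M"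
    using lower_density_eq_0_sparse_segments[OF assms, of "(1/2) ^ _"] by simp
  then obtain M where M: "\<And>k. 2 ^ k \<le> M k" "\<And>k. 0 < M k"
      "\<And>k. real (card ({..<M k} \<inter> I)) \<le> (1/2) ^ k * real (M k)"
    by metis
  define u where "u = (\<lambda>k. uniform_weight (M k))"
  define a where "a = (\<lambda>n. \<Sum>k. u k n)"
  have geom: "summable (\<lambda>k. (1/2::real) ^ k)" by (simp add: summable_geometric)
  have u_ge0: "0 \<le> u k n" for k n by (simp add: u_def uniform_weight_def)
  have u_le: "u k n \<le> (1/2) ^ k" for k n
  proof -
    have "(2::real) ^ k \<le> real (M k)" using M(1)[of k] by (metis of_nat_le_iff of_nat_numeral of_nat_power)
    then show ?thesis using M(2)[of k] by (simp add: u_def uniform_weight_def power_one_over frac_le)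
  qed
  have summ: "summable (\<lambda>k. u k n)" for n
    using u_ge0 u_le by (intro summable_comparison_test'[OF geom]) auto
  have sum_a: "(\<Sum>n\<in>A. a n) = (\<Sum>k. \<Sum>n\<in>A. u k n)" for A
    unfolding a_def using summ by (intro suminf_sum[symmetric]) auto
  have "0 < a n" for n
  proof -
    have "n < M n" using M(1)[of n] less_exp[of n] by linarith
    then have "0 < u n n" by (simp add: u_def uniform_weight_def)
    then show ?thesis unfolding a_def using suminf_pos_iff[OF summ u_ge0] by blast
  qed
  moreover have "decseq a"
    unfolding a_def decseq_Suc_iff
    by (intro allI suminf_le summ) (auto simp: u_def uniform_weight_def)
  moreover have "a \<longlonglongrightarrow> 0"
  proof -
    have "(\<lambda>n. u k n) \<longlonglongrightarrow> 0" for k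
      by (rule tendsto_eventually)
        (auto simp: u_def uniform_weight_def eventually_sequentially intro!: exI[of _ "M k"])
    then have "(\<lambda>n. \<Sum>k. u k n) \<longlonglongrightarrow> (\<Sum>k. 0)"
      using tannerys_theorem[where a = u and b = "\<lambda>_. 0" and F = sequentially, OF _ _ geom]
        u_ge0 u_le by (simp add: always_eventually)
    then show ?thesis by (simp add: a_def)
  qed
  moreover have "filterlim (\<lambda>N. \<Sum>n=0..N. a n) at_top sequentially"
    unfolding filterlim_at_top_ge[where c = 0]
  proof (intro allI impI)
    fix Z :: real
    define K where "K = nat \<lceil>Z\<rceil>"
    have "Z \<le> (\<Sum>n=0..N. a n)" if N: "N \<ge> (\<Sum>k<K. M k)" for N
    proof -
      \<comment> \<open>The segment \<open>{..<M k}\<close> lies inside \<open>{0..N}\<close>, so all its unit mass is counted.\<close>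
      have "(\<Sum>n=0..N. u k n) = 1" if "k < K" for k
      proof -
        have "M k \<le> N" using member_le_sum[of k "{..<K}" M] that N by simp
        then have "{..<M k} \<inter> {0..N} = {..<M k}" by auto
        then show ?thesis using M(2)[of k] by (simp add: u_def sum_uniform_weight)
      qed
      then have "real K = (\<Sum>k<K. \<Sum>n=0..N. u k n)" by simp
      also have "\<dots> \<le> (\<Sum>k. \<Sum>n=0..N. u k n)"
        using u_ge0 summ by (intro sum_le_suminf summable_sum sum_nonneg) auto
      finally show ?thesis unfolding sum_a K_def by linarith
    qed
    then show "\<forall>\<^sub>F N in sequentially. Z \<le> (\<Sum>n=0..N. a n)"
      unfolding eventually_sequentially by blast
  qed
  ultimately have adm: "a \<in> admissible_weights"
    by (simp add: admissible_weights_def)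
  have "(\<Sum>n\<in>{0..N} \<inter> I. a n) \<le> (\<Sum>k. (1/2) ^ k)" for N
    unfolding sum_a
  proof (intro suminf_le geom summable_sum summ)
    fix k
    have "card ({..<M k} \<inter> ({0..N} \<inter> I)) \<le> card ({..<M k} \<inter> I)"
      by (intro card_mono) auto
    then have "real (card ({..<M k} \<inter> ({0..N} \<inter> I))) \<le> (1/2) ^ k * real (M k)"
      using M(3)[of k] by linarith
    then show "(\<Sum>n\<in>{0..N} \<inter> I. u k n) \<le> (1/2) ^ k"
      using M(2)[of k] by (simp add: u_def sum_uniform_weight divide_le_eq)
  qed
  from that[OF adm upper_density_wrt_eq_0[OF adm this]] show ?thesis .
qed

section \<open>Frequent hypercyclicity through weighted densities\<close>

lemma FHC_subset_FHC_wrt: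
  assumes "a \<in> admissible_weights"
  shows "FHC T \<subseteq> FHC_wrt a T"
  unfolding FHC_def FHC_wrt_def
  using less_le_trans[OF _ lower_density_le_lower_density_wrt[OF assms]] by blast

lemma FHC_wrt_subset_UFHC_wrt: "FHC_wrt a T \<subseteq> UFHC_wrt a T"
proof -
  have "lower_density_wrt a I \<le> upper_density_wrt a I" for I
    unfolding lower_density_wrt_def upper_density_wrt_def by (intro Liminf_le_Limsup) simp
  then have "0 < upper_density_wrt a I" if "0 < lower_density_wrt a I" for I
    using that by (rule less_le_trans[rotated])
  then show ?thesis unfolding FHC_wrt_def UFHC_wrt_def by blast
qed

lemma INT_UFHC_wrt_subset_FHC: "(\<Inter>a\<in>admissible_weights. UFHC_wrt a T) \<subseteq> FHC T"
proof
  fix x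
  assume x: "x \<in> (\<Inter>a\<in>admissible_weights. UFHC_wrt a T)"
  show "x \<in> FHC T"
  proof (rule ccontr)
    assume "x \<notin> FHC T"
    then obtain U where U: "open U" "U \<noteq> {}" "\<not> 0 < lower_density (return_times T x U)"
      by (auto simp: FHC_def)
    then obtain a where "a \<in> admissible_weights" "upper_density_wrt a (return_times T x U) = 0"
      using obtain_weight_with_zero_upper_density by blast
    then show False using x U by (force simp: UFHC_wrt_def)
  qed
qed

theorem theorem1p4:
  fixes smul :: "'k::real_normed_field \<Rightarrow> 'a::{ab_group_add, topological_space} \<Rightarrow> 'a"
    and T :: "'a \<Rightarrow> 'a"
  assumes "frechet_space smul"
    and "separable_space (euclidean :: 'a topology)"
    and "\<not> (\<exists>B. finite_dimensional_vector_space smul B)"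
    and "Vector_Spaces.linear smul smul T"
    and "continuous_on UNIV T"
  shows "FHC T = (\<Inter>a\<in>admissible_weights. FHC_wrt a T) \<and>
         (\<Inter>a\<in>admissible_weights. FHC_wrt a T) = (\<Inter>a\<in>admissible_weights. UFHC_wrt a T)"
proof -
  have "FHC T \<subseteq> (\<Inter>a\<in>admissible_weights. FHC_wrt a T)"
    by (intro INT_greatest FHC_subset_FHC_wrt)
  moreover have "(\<Inter>a\<in>admissible_weights. FHC_wrt a T) \<subseteq> (\<Inter>a\<in>admissible_weights. UFHC_wrt a T)"
    by (intro INT_anti_mono subset_refl FHC_wrt_subset_UFHC_wrt)
  ultimately show ?thesis using INT_UFHC_wrt_subset_FHC[of T] by (meson subset_antisym subset_trans)
qed

end
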